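(* Let $P$ be a sum-indecomposable poset of height $k+2$ with $k\ge 0$, and let $Q_0,\dots,Q_k$ be its quarks. Then $P$ is $(\mathbf{3+1})$-avoiding if and only if for every $i\in\{0,\dots,k-1\}$ such that $P(i+1)$ contains no all-seeing element, either $Q_i$ has no isolated element in its lower part or $Q_{i+1}$ has no isolated element in its upper part (or both).
   Context: All posets are finite. A poset $P$ is weakly graded if there is $\operatorname{rk}:P\to\mathbb{N}$ with $\operatorname{rk}(b)=\operatorname{rk}(a)+1$ whenever $b$ covers $a$ and minimum rank $0$ on each connected component; it is strongly graded if moreover all minimal elements have equal rank and all maximal elements have equal rank. The height is the number of elements of a longest chain; $P(i)$ is the set of elements of rank $i$, so a strongly graded poset of height $k+2$ has ranks $0,\dots,k+1$. An element $v$ of rank $i$ is up-seeing if every element of $P(i+1)$ covers $v$, down-seeing if $v$ covers every element of $P(i-1)$ (vacuous if that set is empty), all-seeing if both; $P$ is vigilant if every element is up-seeing or down-seeing. A trimmed poset is a weakly graded vigilant poset in which each rank contains at most one all-seeing element (all-seeing elements unlabeled, others labeled by $[m]$). A nonempty strongly graded poset of height $h$ is sum-indecomposable if it is trimmed and there is no $i<h-1$ for which every element of $P(i)$ is up-seeing. For a sum-indecomposable $P$ of height $k+2$, its quark decomposition consists of $Q_0,\dots,Q_k$, where $Q_i$ is the induced subposet on $Q_i(0)\cup Q_i(1)$ with lower part $Q_i(0)$ equal to $P(0)$ if $i=0$ and to the set of non-up-seeing elements of $P(i)$ if $i\ge1$, and upper part $Q_i(1)$ equal to $P(k+1)$ if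 $i=k$ and to the set of non-down-seeing elements of $P(i+1)$ if $i<k$. An element $u\in Q_i(0)$ is isolated (in the lower part of $Q_i$) if it is below no element of $Q_i(1)$; an element $w\in Q_i(1)$ is isolated (in the upper part) if it is above no element of $Q_i(0)$. (In the paper's terminology, $Q_i$ and $Q_{i+1}$ are "stuck" rather than "glued" exactly when $P(i+1)$ has no all-seeing element.) A poset is $(\mathbf{3+1})$-avoiding if there are no four elements $x,y,z,w$ with $x<y<z$ and $w$ incomparable to each of $x,y,z$. *)

theory Defs
  imports Main
begin

text \<open>
  A poset is a relation \<open>P\<close> with \<open>Partial_order P\<close>; its set of elements is \<open>Field P\<close>
  (by reflexivity every element occurs in \<open>P\<close>, isolated points included).
  The labels carried by trimmed posets are names for elements, which the type \<open>'a\<close>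
  already provides; they impose no condition on the order.
\<close>

definition finite_poset :: "'a rel \<Rightarrow> bool" where
  "finite_poset P \<longleftrightarrow> Partial_order P \<and> finite (Field P)"

definition strictly_below :: "'a rel \<Rightarrow> 'a \<Rightarrow> 'a \<Rightarrow> bool" where
  "strictly_below P a b \<longleftrightarrow> (a, b) \<in> P \<and> a \<noteq> b"

definition incomparable :: "'a rel \<Rightarrow> 'a \<Rightarrow> 'a \<Rightarrow> bool" where
  "incomparable P a b \<longleftrightarrow> (a, b) \<notin> P \<and> (b, a) \<notin> P"

definition covers :: "'a rel \<Rightarrow> 'a \<Rightarrow> 'a \<Rightarrow> bool" where
  "covers P b a \<longleftrightarrow> strictly_below P a b \<and> \<not> (\<exists>c. strictly_below P a c \<and> strictly_below P c b)"

definition minimal_elements :: "'a rel \<Rightarrow> 'a set" where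
  "minimal_elements P = {x \<in> Field P. \<not> (\<exists>y. strictly_below P y x)}"

definition maximal_elements :: "'a rel \<Rightarrow> 'a set" where
  "maximal_elements P = {x \<in> Field P. \<not> (\<exists>y. strictly_below P x y)}"

text \<open>
  Two elements lie in the same connected component iff they are related by
  \<open>(P \<union> P\<inverse>)\<^sup>*\<close>. As ranks are natural numbers, a component has minimum rank \<open>0\<close>
  iff rank \<open>0\<close> is attained on it.
\<close>

definition is_rank_function :: "'a rel \<Rightarrow> ('a \<Rightarrow> nat) \<Rightarrow> bool" where
  "is_rank_function P rk \<longleftrightarrow>
     (\<forall>a b. covers P b a \<longrightarrow> rk b = rk a + 1) \<and>
     (\<forall>x \<in> Field P. \<exists>y \<in> Field P. (x, y) \<in> (P \<union> P\<inverse>)\<^sup>* \<and> rk y = 0)"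

definition weakly_graded :: "'a rel \<Rightarrow> bool" where
  "weakly_graded P \<longleftrightarrow> finite_poset P \<and> (\<exists>rk. is_rank_function P rk)"

text \<open>
  On a weakly graded poset the rank function is uniquely determined on \<open>Field P\<close>, so
  the choice below is immaterial; its values outside \<open>Field P\<close> are never used.
\<close>

definition poset_rank :: "'a rel \<Rightarrow> 'a \<Rightarrow> nat" where
  "poset_rank P = (SOME rk. is_rank_function P rk)"

definition level :: "'a rel \<Rightarrow> nat \<Rightarrow> 'a set" where
  "level P i = {x \<in> Field P. poset_rank P x = i}"

definition strongly_graded :: "'a rel \<Rightarrow> bool" where
  "strongly_graded P \<longleftrightarrow> weakly_graded P \<and>
     (\<forall>x \<in> minimal_elements P. \<forall>y \<in> minimal_elements P. poset_rank P x = poset_rank P y) \<and>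
     (\<forall>x \<in> maximal_elements P. \<forall>y \<in> maximal_elements P. poset_rank P x = poset_rank P y)"

definition height :: "'a rel \<Rightarrow> nat" where
  "height P = Max (card ` Chains P)"

definition up_seeing :: "'a rel \<Rightarrow> 'a \<Rightarrow> bool" where
  "up_seeing P v \<longleftrightarrow> (\<forall>w \<in> level P (poset_rank P v + 1). covers P w v)"

text \<open>
  The predecessor level is described without subtraction, so that the condition is
  vacuous for \<open>v\<close> of rank \<open>0\<close>.
\<close>

definition down_seeing :: "'a rel \<Rightarrow> 'a \<Rightarrow> bool" where
  "down_seeing P v \<longleftrightarrow> (\<forall>j. poset_rank P v = j + 1 \<longrightarrow> (\<forall>u \<in> level P j. covers P v u))"

definition all_seeing :: "'a rel \<Rightarrow> 'a \<Rightarrow> bool" where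
  "all_seeing P v \<longleftrightarrow> up_seeing P v \<and> down_seeing P v"

definition vigilant :: "'a rel \<Rightarrow> bool" where
  "vigilant P \<longleftrightarrow> (\<forall>v \<in> Field P. up_seeing P v \<or> down_seeing P v)"

definition trimmed :: "'a rel \<Rightarrow> bool" where
  "trimmed P \<longleftrightarrow> weakly_graded P \<and> vigilant P \<and>
     (\<forall>i. \<forall>u \<in> level P i. \<forall>v \<in> level P i. all_seeing P u \<and> all_seeing P v \<longrightarrow> u = v)"

definition sum_indecomposable :: "'a rel \<Rightarrow> bool" where
  "sum_indecomposable P \<longleftrightarrow> Field P \<noteq> {} \<and> strongly_graded P \<and> trimmed P \<and>
     \<not> (\<exists>i. i + 1 < height P \<and> (\<forall>v \<in> level P i. up_seeing P v))"

text \<open>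
  The quarks \<open>Q\<^sub>0, \<dots>, Q\<^sub>k\<close> of a poset of height \<open>k + 2\<close>; thus \<open>i = k\<close> is
  expressed as \<open>i + 2 = height P\<close>.
\<close>

definition quark_lower :: "'a rel \<Rightarrow> nat \<Rightarrow> 'a set" where
  "quark_lower P i = (if i = 0 then level P 0 else {v \<in> level P i. \<not> up_seeing P v})"

definition quark_upper :: "'a rel \<Rightarrow> nat \<Rightarrow> 'a set" where
  "quark_upper P i = (if i + 2 = height P then level P (i + 1)
                      else {v \<in> level P (i + 1). \<not> down_seeing P v})"

definition quark :: "'a rel \<Rightarrow> nat \<Rightarrow> 'a rel" where
  "quark P i = Restr P (quark_lower P i \<union> quark_upper P i)"

definition isolated_lower :: "'a rel \<Rightarrow> nat \<Rightarrow> 'a \<Rightarrow> bool" where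
  "isolated_lower P i u \<longleftrightarrow>
     u \<in> quark_lower P i \<and> \<not> (\<exists>w \<in> quark_upper P i. strictly_below (quark P i) u w)"

definition isolated_upper :: "'a rel \<Rightarrow> nat \<Rightarrow> 'a \<Rightarrow> bool" where
  "isolated_upper P i w \<longleftrightarrow>
     w \<in> quark_upper P i \<and> \<not> (\<exists>u \<in> quark_lower P i. strictly_below (quark P i) u w)"

definition three_plus_one_avoiding :: "'a rel \<Rightarrow> bool" where
  "three_plus_one_avoiding P \<longleftrightarrow>
     \<not> (\<exists>x \<in> Field P. \<exists>y \<in> Field P. \<exists>z \<in> Field P. \<exists>w \<in> Field P.
          strictly_below P x y \<and> strictly_below P y z \<and>
          incomparable P w x \<and> incomparable P w y \<and> incomparable P w z)"

end

theory Submission imports Defs begin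

text \<open>
  Elements of a sum-indecomposable poset whose ranks differ by at least two are comparable
  as soon as the quark condition holds: if \<open>u\<close> of rank \<open>i\<close> and \<open>v\<close> of rank \<open>i + 2\<close> are
  incomparable, vigilance makes \<open>u\<close> isolated in \<open>Q\<^sub>i\<close> and \<open>v\<close> isolated in \<open>Q\<^sub>i\<^sub>+\<^sub>1\<close>, and
  rules out all-seeing elements in between. Hence an element incomparable to a chain
  \<open>x < y < z\<close> has the rank of \<open>y\<close> and sees neither \<open>x\<close> nor \<open>z\<close>, against vigilance.
  Conversely, let \<open>u\<close> and \<open>w\<close> be isolated in \<open>Q\<^sub>i\<close> and \<open>Q\<^sub>i\<^sub>+\<^sub>1\<close>, with no all-seeing element of
  rank \<open>i + 1\<close>. Everything covered by \<open>w\<close> is up-seeing and everything covering \<open>u\<close> is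
  down-seeing, so a chain \<open>a < b < w\<close> of consecutive ranks together with \<open>u\<close> is a
  forbidden configuration.
\<close>

section \<open>Covers in a finite poset\<close>

lemma strictly_below_Field:
  assumes "strictly_below P a b"
  shows "a \<in> Field P" "b \<in> Field P"
  using assms by (auto simp: strictly_below_def Field_def)

lemma strictly_below_trans:
  assumes "Partial_order P" "strictly_below P a b" "strictly_below P b c"
  shows "strictly_below P a c"
proof -
  have "trans P" "antisym P"
    using assms(1) by (auto simp: order_on_defs)
  then show ?thesis
    using assms(2,3) unfolding strictly_below_def by (metis antisymD transD)
qed

lemma finite_poset_converse: "finite_poset (P\<inverse>) = finite_poset P"
  by (simp add: finite_poset_def)

lemma covers_converse: "covers (P\<inverse>) a b = covers P b a"
  unfolding covers_def strictly_below_def by auto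

text \<open>Among the elements strictly above \<open>a\<close> and at most \<open>b\<close>, one
  with the fewest elements strictly below it covers \<open>a\<close>: anything in between would be a
  candidate with a strictly smaller down-set.\<close>

lemma ex_cover_above:
  assumes P: "finite_poset P" and ab: "strictly_below P a b"
  shows "\<exists>c. covers P c a \<and> (c, b) \<in> P"
proof -
  let ?S = "\<lambda>c. strictly_below P a c \<and> (c, b) \<in> P"
  let ?D = "\<lambda>c. {e. strictly_below P e c}"
  have po: "Partial_order P" and tr: "trans P" and re: "refl_on (Field P) P"
    using P by (auto simp: finite_poset_def order_on_defs)
  have "?S b"
    using ab re strictly_below_Field[OF ab] by (auto dest: refl_onD)
  then obtain c where c: "?S c" and least: "\<And>d. ?S d \<Longrightarrow> card (?D c) \<le> card (?D d)"
    using ex_has_least_nat[of ?S b "\<lambda>c. card (?D c)"] by blast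
  have "\<not> strictly_below P d c" if ad: "strictly_below P a d" for d
  proof
    assume dc: "strictly_below P d c"
    then have "?S d"
      using ad c tr unfolding strictly_below_def by (meson transD)
    moreover have "?D d \<subset> ?D c"
      using strictly_below_trans[OF po _ dc] dc by (auto simp: strictly_below_def)
    moreover have "finite (?D c)"
      using P strictly_below_Field(1)
      by (metis (no_types, lifting) finite_poset_def finite_subset mem_Collect_eq subsetI)
    ultimately show False
      using least psubset_card_mono by (metis leD)
  qed
  then show ?thesis
    using c unfolding covers_def by blast
qed

lemma ex_cover_below:
  assumes "finite_poset P" "strictly_below P a b"
  shows "\<exists>c. covers P b c \<and> (a, c) \<in> P"
proof -
  have "strictly_below (P\<inverse>) b a"
    using assms(2) by (auto simp: strictly_below_def)
  then show ?thesis
    using ex_cover_above[of "P\<inverse>" b a] assms(1)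
    by (simp add: finite_poset_converse covers_converse)
qed

lemma covers_Field:
  assumes "covers P b a"
  shows "a \<in> Field P" "b \<in> Field P"
  using assms strictly_below_Field unfolding covers_def by metis+

section \<open>Rank and strict order\<close>

lemma weakly_graded_rank:
  assumes "weakly_graded P"
  shows "is_rank_function P (poset_rank P)"
  using assms someI_ex[of "is_rank_function P"] unfolding weakly_graded_def poset_rank_def
  by blast

lemma rank_covers:
  assumes "weakly_graded P" "covers P b a"
  shows "poset_rank P b = poset_rank P a + 1"
  using weakly_graded_rank[OF assms(1)] assms(2) unfolding is_rank_function_def by blast

lemma rank_strict_mono:
  assumes wg: "weakly_graded P" and ab: "strictly_below P a b"
  shows "poset_rank P a < poset_rank P b"
proof -
  have fp: "finite_poset P" and po: "Partial_order P"
    using wg by (auto simp: weakly_graded_def finite_poset_def)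
  have "strictly_below P a b \<Longrightarrow> poset_rank P a < poset_rank P b" for a
  \<comment> \<open>The number of elements strictly above \<open>a\<close> drops when
    \<open>a\<close> is replaced by one of its covers, so one can climb from \<open>a\<close> to
    \<open>b\<close> cover by cover.\<close>
  proof (induction "card {e. strictly_below P a e}" arbitrary: a rule: less_induct)
    case less
    then obtain c where c: "covers P c a" "(c, b) \<in> P"
      using ex_cover_above[OF fp] by blast
    show ?case
    proof (cases "c = b")
      case True
      then show ?thesis using rank_covers[OF wg c(1)] by simp
    next
      case False
      then have cb: "strictly_below P c b"
        using c by (simp add: strictly_below_def)
      have ac: "strictly_below P a c"
        using c by (simp add: covers_def)
      have "finite {e. strictly_below P a e}"
        using fp strictly_below_Field(2)
        by (metis (no_types, lifting) finite_poset_def finite_subset mem_Collect_eq subsetI)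
      moreover have "{e. strictly_below P c e} \<subset> {e. strictly_below P a e}"
        using strictly_below_trans[OF po ac] ac by (auto simp: strictly_below_def)
      ultimately have "poset_rank P c < poset_rank P b"
        using less.hyps[of c] cb psubset_card_mono by blast
      then show ?thesis using rank_covers[OF wg c(1)] by simp
    qed
  qed
  then show ?thesis using ab .
qed

text \<open>By strict monotonicity, an element in between would have a rank strictly between two
  consecutive numbers.\<close>

lemma covers_if_consecutive_rank:
  assumes "weakly_graded P" "strictly_below P a b" "poset_rank P b = poset_rank P a + 1"
  shows "covers P b a"
  unfolding covers_def
proof (intro conjI notI)
  show "strictly_below P a b" by fact
  assume "\<exists>c. strictly_below P a c \<and> strictly_below P c b"
  then obtain c where "strictly_below P a c" "strictly_below P c b" by blast
  then have "poset_rank P a < poset_rank P c" "poset_rank P c < poset_rank P b"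
    using rank_strict_mono[OF assms(1)] by blast+
  then show False using assms(3) by simp
qed

section \<open>Strong grading: neighbouring levels and height\<close>

lemma minimal_rank_0:
  assumes sg: "strongly_graded P" and x: "x \<in> minimal_elements P"
  shows "poset_rank P x = 0"
proof -
  have wg: "weakly_graded P" using sg by (simp add: strongly_graded_def)
  have "x \<in> Field P" using x by (simp add: minimal_elements_def)
  \<comment> \<open>The component of \<open>x\<close> attains rank 0; such an element is minimal,
    and strong grading transfers its rank to \<open>x\<close>.\<close>
  then obtain y where y: "y \<in> Field P" "poset_rank P y = 0"
    using weakly_graded_rank[OF wg] unfolding is_rank_function_def by blast
  then have "y \<in> minimal_elements P"
    using rank_strict_mono[OF wg] unfolding minimal_elements_def by fastforce
  then show ?thesis
    using sg x y unfolding strongly_graded_def by metis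
qed

lemma ex_covered:
  assumes sg: "strongly_graded P" and v: "v \<in> level P (Suc j)"
  shows "\<exists>u \<in> level P j. covers P v u"
proof -
  have wg: "weakly_graded P" using sg by (simp add: strongly_graded_def)
  have "v \<notin> minimal_elements P"
    using minimal_rank_0[OF sg] v by (auto simp: level_def)
  then obtain a where "strictly_below P a v"
    using v by (auto simp: minimal_elements_def level_def)
  then obtain u where "covers P v u"
    using ex_cover_below[of P a v] wg unfolding weakly_graded_def by blast
  then have "u \<in> level P j"
    using rank_covers[OF wg, of v u] covers_Field(1)[of P v u] v by (simp add: level_def)
  then show ?thesis
    using \<open>covers P v u\<close> by blast
qed

text \<open>An element of greatest rank is maximal, and all maximal elements share its rank.\<close>

lemma rank_le_if_maximal:
  assumes sg: "strongly_graded P" and m: "m \<in> maximal_elements P" and v: "v \<in> Field P"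
  shows "poset_rank P v \<le> poset_rank P m"
proof -
  have wg: "weakly_graded P" using sg by (simp add: strongly_graded_def)
  let ?R = "poset_rank P ` Field P"
  have fin: "finite ?R"
    using wg by (simp add: weakly_graded_def finite_poset_def)
  then have "Max ?R \<in> ?R" using v by (intro Max_in) auto
  then obtain t where t: "t \<in> Field P" "poset_rank P t = Max ?R" by auto
  have le: "poset_rank P s \<le> poset_rank P t" if "s \<in> Field P" for s
    using fin that t by simp
  have "t \<in> maximal_elements P"
    unfolding maximal_elements_def mem_Collect_eq
    using t(1) le[OF strictly_below_Field(2)] rank_strict_mono[OF wg] by (meson leD)
  then have "poset_rank P t = poset_rank P m"
    using sg m unfolding strongly_graded_def by metis
  then show ?thesis using le[OF v] by simp
qed

text \<open>Here \<open>v\<close> witnesses that \<open>j\<close> is not the top rank, so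
  \<open>u\<close> cannot be maximal.\<close>

lemma ex_covering:
  assumes sg: "strongly_graded P" and u: "u \<in> level P j" and v: "v \<in> Field P"
    and less: "j < poset_rank P v"
  shows "\<exists>y \<in> level P (Suc j). covers P y u"
proof -
  have wg: "weakly_graded P" using sg by (simp add: strongly_graded_def)
  have "u \<notin> maximal_elements P"
    using rank_le_if_maximal[OF sg, of u v] v less u by (auto simp: level_def)
  then obtain b where "strictly_below P u b"
    using u by (auto simp: maximal_elements_def level_def)
  then obtain y where "covers P y u"
    using ex_cover_above[of P u b] wg unfolding weakly_graded_def by blast
  then have "y \<in> level P (Suc j)"
    using rank_covers[OF wg, of y u] covers_Field(2)[of P y u] u by (simp add: level_def)
  then show ?thesis
    using \<open>covers P y u\<close> by blast
qed

lemma rank_less_height: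
  assumes sg: "strongly_graded P" and v: "v \<in> Field P"
  shows "poset_rank P v < height P"
proof -
  have wg: "weakly_graded P" using sg by (simp add: strongly_graded_def)
  have tr: "trans P" and re: "refl_on (Field P) P" and fin: "finite (Field P)"
    using wg by (auto simp: weakly_graded_def finite_poset_def order_on_defs)
  have chain_Field: "C \<subseteq> Field P" if "C \<in> Chains P" for C
    using that by (auto simp: Chains_def Field_def)
  \<comment> \<open>Descending from \<open>v\<close> through covers to rank 0 yields one element per
    rank. Keeping the whole chain below its top makes it extendable by the next cover.\<close>
  have "\<exists>C \<in> Chains P. card C = Suc j \<and> (\<forall>c \<in> C. (c, v) \<in> P)" if "v \<in> level P j" for j v
    using that
  proof (induction j arbitrary: v)
    case 0
    then have "(v, v) \<in> P"
      using re by (auto simp: level_def dest: refl_onD)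
    then show ?case
      by (intro bexI[of _ "{v}"]) (auto simp: Chains_def)
  next
    case (Suc j)
    then obtain u where u: "u \<in> level P j" "covers P v u"
      using ex_covered[OF sg] by blast
    then obtain C where C: "C \<in> Chains P" "card C = Suc j" "\<forall>c \<in> C. (c, u) \<in> P"
      using Suc.IH by blast
    have uv: "strictly_below P u v" using u by (simp add: covers_def)
    have below: "(c, v) \<in> P" if "c \<in> C" for c
      using that C(3) uv tr unfolding strictly_below_def by (meson transD)
    have "v \<notin> C"
    proof
      assume "v \<in> C"
      then have "strictly_below P v u"
        using C(3) uv by (auto simp: strictly_below_def)
      then show False
        using rank_strict_mono[OF wg] uv by (meson less_asym)
    qed
    moreover have "finite C"
      using C(1) chain_Field fin finite_subset by blast
    moreover have "(v, v) \<in> P"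
      using re Suc.prems by (auto simp: level_def dest: refl_onD)
    ultimately show ?case
      using C below by (intro bexI[of _ "insert v C"]) (auto simp: Chains_def)
  qed
  from this[of v] obtain C where C: "C \<in> Chains P" "card C = Suc (poset_rank P v)"
    using v by (auto simp: level_def)
  have "Chains P \<subseteq> Pow (Field P)" using chain_Field by blast
  then have "finite (Chains P)"
    using fin finite_subset by blast
  then have "card C \<le> height P"
    unfolding height_def using C(1) by simp
  then show ?thesis using C(2) by simp
qed

section \<open>Elements two ranks apart\<close>

lemma no_path_between_ranks:
  assumes sg: "strongly_graded P" and vg: "vigilant P"
    and u: "u \<in> level P i" and v: "v \<in> level P (i + 2)" and nb: "(u, v) \<notin> P"
  shows "\<not> up_seeing P u" "\<not> down_seeing P v"
    "\<And>y. y \<in> level P (i + 1) \<Longrightarrow> covers P y u \<Longrightarrow> down_seeing P y \<and> \<not> up_seeing P y"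
    "\<And>y. y \<in> level P (i + 1) \<Longrightarrow> covers P v y \<Longrightarrow> up_seeing P y \<and> \<not> down_seeing P y"
proof -
  have po: "Partial_order P"
    using sg by (simp add: strongly_graded_def weakly_graded_def finite_poset_def)
  \<comment> \<open>All four claims rest on this: each kind of seeing that they deny would complete
    a path \<open>u < y < v\<close>.\<close>
  have none: False if "covers P y u" "covers P v y" for y
    using that nb strictly_below_trans[OF po] unfolding covers_def strictly_below_def by metis
  have up: "covers P v y" if "up_seeing P y" "y \<in> level P (i + 1)" for y
    using that v by (simp add: up_seeing_def level_def)
  have down: "covers P y u" if "down_seeing P y" "y \<in> level P (i + 1)" for y
    using that u by (simp add: down_seeing_def level_def)
  obtain y where y: "y \<in> level P (i + 1)" "covers P y u"
    using ex_covering[OF sg u, of v] v by (auto simp: level_def)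
  obtain y' where y': "y' \<in> level P (i + 1)" "covers P v y'"
    using ex_covered[OF sg, of v "i + 1"] v by auto
  have "covers P v y" if "down_seeing P v"
    using that y(1) v by (simp add: down_seeing_def level_def)
  then show "\<not> down_seeing P v" using none y by blast
  have "covers P y' u" if "up_seeing P u"
    using that y'(1) u by (simp add: up_seeing_def level_def)
  then show "\<not> up_seeing P u" using none y' by blast
  \<comment> \<open>Once one direction of seeing is excluded for a middle element, vigilance
    supplies the other.\<close>
  have vig: "up_seeing P y \<or> down_seeing P y" if "y \<in> level P (i + 1)" for y
    using that vg by (simp add: vigilant_def level_def)
  show "down_seeing P y \<and> \<not> up_seeing P y" if "y \<in> level P (i + 1)" "covers P y u" for y
    using that vig none up by blast
  show "up_seeing P y \<and> \<not> down_seeing P y" if "y \<in> level P (i + 1)" "covers P v y" for y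
    using that vig none down by blast
qed

text \<open>The two parts of a quark lie in adjacent levels, so isolation can be tested by covers in
  \<open>P\<close>.\<close>

lemma strictly_below_quark_iff:
  assumes "u \<in> quark_lower P i" "w \<in> quark_upper P i" "weakly_graded P"
  shows "strictly_below (quark P i) u w \<longleftrightarrow> covers P w u"
proof -
  have "poset_rank P w = poset_rank P u + 1"
    using assms by (auto simp: quark_lower_def quark_upper_def level_def split: if_splits)
  then show ?thesis
    using assms covers_if_consecutive_rank[OF assms(3), of u w]
    by (auto simp: quark_def strictly_below_def covers_def)
qed

lemma isolated_if_no_path:
  assumes sg: "strongly_graded P" and vg: "vigilant P"
    and u: "u \<in> level P i" and v: "v \<in> level P (i + 2)" and nb: "(u, v) \<notin> P"
  shows "isolated_lower P i u" "isolated_upper P (i + 1) v"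
    "\<not> (\<exists>y \<in> level P (i + 1). all_seeing P y)"
proof -
  have wg: "weakly_graded P" using sg by (simp add: strongly_graded_def)
  note np = no_path_between_ranks[OF assms]
  \<comment> \<open>The rank of \<open>v\<close> shows that \<open>i\<close> is not the last quark
    index, so the special case of \<open>quark_upper\<close> does not apply to
    \<open>i\<close>.\<close>
  have "i + 2 < height P"
    using rank_less_height[OF sg, of v] v by (simp add: level_def)
  then have upper: "quark_upper P i = {y \<in> level P (i + 1). \<not> down_seeing P y}"
    by (simp add: quark_upper_def)
  have lower: "quark_lower P (i + 1) = {y \<in> level P (i + 1). \<not> up_seeing P y}"
    by (simp add: quark_lower_def)
  have u': "u \<in> quark_lower P i"
    using u np(1) by (auto simp: quark_lower_def)
  have v': "v \<in> quark_upper P (i + 1)"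
    using v np(2) by (simp add: quark_upper_def)
  show "isolated_lower P i u"
    using u' np(3) strictly_below_quark_iff[OF u' _ wg] unfolding isolated_lower_def upper
    by blast
  show "isolated_upper P (i + 1) v"
    using v' np(4) strictly_below_quark_iff[OF _ v' wg] unfolding isolated_upper_def lower
    by blast
  show "\<not> (\<exists>y \<in> level P (i + 1). all_seeing P y)"
  proof
    assume "\<exists>y \<in> level P (i + 1). all_seeing P y"
    then obtain y where y: "y \<in> level P (i + 1)" "all_seeing P y" by blast
    \<comment> \<open>An all-seeing \<open>y\<close> would be an up-seeing cover of
      \<open>u\<close>, which is already excluded.\<close>
    then have "covers P y u"
      using u by (simp add: all_seeing_def down_seeing_def level_def)
    then show False using np(3) y by (auto simp: all_seeing_def)
  qed
qed

section \<open>Avoidance from comparability across rank gaps\<close>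

lemma below_if_rank_gap:
  assumes sg: "strongly_graded P"
    and two: "\<And>i u v. u \<in> level P i \<Longrightarrow> v \<in> level P (i + 2) \<Longrightarrow> (u, v) \<in> P"
    and u: "u \<in> Field P" and v: "v \<in> Field P"
    and gap: "poset_rank P u + 2 \<le> poset_rank P v"
  shows "(u, v) \<in> P"
proof -
  have tr: "trans P"
    using sg by (simp add: strongly_graded_def weakly_graded_def finite_poset_def order_on_defs)
  \<comment> \<open>\<open>n\<close> is the excess of the rank gap over two; passing to a cover of
    \<open>u\<close> lowers it by one.\<close>
  have "(u, v) \<in> P" if "u \<in> level P i" "v \<in> level P (i + 2 + n)" for n i u
    using that
  proof (induction n arbitrary: u i)
    case 0
    then show ?case using two by simp
  next
    case (Suc n)
    then obtain y where y: "y \<in> level P (Suc i)" "covers P y u"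
      using ex_covering[OF sg, of u i v] by (auto simp: level_def)
    then have "(y, v) \<in> P" using Suc.IH[of y "Suc i"] Suc.prems(2) by simp
    then show ?case
      using y(2) tr unfolding covers_def strictly_below_def by (meson transD)
  qed
  from this[of u "poset_rank P u" "poset_rank P v - poset_rank P u - 2"] show ?thesis
    using u v gap by (simp add: level_def)
qed

lemma three_plus_one_avoiding_if_rank_gap:
  assumes sg: "strongly_graded P" and vg: "vigilant P"
    and two: "\<And>i u v. u \<in> level P i \<Longrightarrow> v \<in> level P (i + 2) \<Longrightarrow> (u, v) \<in> P"
  shows "three_plus_one_avoiding P"
  unfolding three_plus_one_avoiding_def
proof (safe)
  fix x y z w
  assume F: "x \<in> Field P" "z \<in> Field P" "w \<in> Field P"
    and xyz: "strictly_below P x y" "strictly_below P y z"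
    and inc: "incomparable P w x" "incomparable P w z"
  have wg: "weakly_graded P" using sg by (simp add: strongly_graded_def)
  have gap: "(a, b) \<in> P"
    if "a \<in> Field P" "b \<in> Field P" "poset_rank P a + 2 \<le> poset_rank P b" for a b
    using below_if_rank_gap[OF sg _ that] two by blast
  have "poset_rank P x < poset_rank P y" "poset_rank P y < poset_rank P z"
    using rank_strict_mono[OF wg] xyz by auto
  moreover have "poset_rank P w < poset_rank P x + 2" "poset_rank P z < poset_rank P w + 2"
    using gap[of x w] gap[of w z] F inc by (fastforce simp: incomparable_def)+
  \<comment> \<open>\<open>w\<close> is less than two ranks above \<open>x\<close> and
    \<open>z\<close> less than two above \<open>w\<close>, while \<open>x\<close> and
    \<open>z\<close> are at least two ranks apart; so \<open>w\<close> sits exactly midway.\<close>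
  ultimately have r: "poset_rank P w = poset_rank P x + 1" "poset_rank P z = poset_rank P w + 1"
    by auto
  have "\<not> down_seeing P w"
    using r F inc
    by (auto simp: down_seeing_def level_def covers_def strictly_below_def incomparable_def)
  moreover have "\<not> up_seeing P w"
    using r F inc
    by (auto simp: up_seeing_def level_def covers_def strictly_below_def incomparable_def)
  ultimately show False
    using vg F by (auto simp: vigilant_def)
qed

section \<open>A forbidden configuration from isolated elements\<close>

lemma not_three_plus_one_avoiding_if_isolated:
  assumes sg: "strongly_graded P" and i: "i + 2 < height P"
    and no_all: "\<And>y. y \<in> level P (i + 1) \<Longrightarrow> \<not> all_seeing P y"
    and u: "isolated_lower P i u" and w: "isolated_upper P (i + 1) w"
  shows "\<not> three_plus_one_avoiding P"
proof -
  have wg: "weakly_graded P" using sg by (simp add: strongly_graded_def)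
  have po: "Partial_order P" and fp: "finite_poset P"
    using wg by (auto simp: weakly_graded_def finite_poset_def)
  have upper: "quark_upper P i = {y \<in> level P (i + 1). \<not> down_seeing P y}"
    using i by (simp add: quark_upper_def)
  have lower: "quark_lower P (i + 1) = {y \<in> level P (i + 1). \<not> up_seeing P y}"
    by (simp add: quark_lower_def)
  have uQ: "u \<in> quark_lower P i" and wQ: "w \<in> quark_upper P (i + 1)"
    using u w by (auto simp: isolated_lower_def isolated_upper_def)
  have ul: "u \<in> level P i" and wl: "w \<in> level P (i + 2)"
    using uQ wQ by (auto simp: quark_lower_def quark_upper_def split: if_splits)
  \<comment> \<open>A cover of the isolated \<open>u\<close> cannot lie in the upper part of its
    quark, which here consists of the elements of the next level that are not down-seeing.\<close>
  have above_u: "down_seeing P y" if "y \<in> level P (i + 1)" "covers P y u" for y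
    using that u strictly_below_quark_iff[OF uQ _ wg] unfolding isolated_lower_def upper
    by blast
  have below_w: "up_seeing P y" if "y \<in> level P (i + 1)" "covers P w y" for y
    using that w strictly_below_quark_iff[OF _ wQ wg] unfolding isolated_upper_def lower
    by blast
  have excl: "\<not> (up_seeing P y \<and> down_seeing P y)" if "y \<in> level P (i + 1)" for y
    using no_all[OF that] by (simp add: all_seeing_def)
  \<comment> \<open>The chain \<open>a < b < w\<close> is built downward from \<open>w\<close>.
    Being covered by \<open>w\<close>, \<open>b\<close> is up-seeing; covering \<open>u\<close> as
    well would make it all-seeing.\<close>
  obtain b where b: "b \<in> level P (i + 1)" "covers P w b"
    using ex_covered[OF sg, of w "i + 1"] wl by auto
  obtain a where a: "a \<in> level P i" "covers P b a"
    using ex_covered[OF sg, of b i] b by auto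
  have ub: "\<not> covers P b u"
    using above_u below_w excl b by blast
  \<comment> \<open>Ranks forbid relations that go down or stay within a level, so for
    \<open>b\<close> and \<open>w\<close> only a relation upward from \<open>u\<close> has to be
    refuted.\<close>
  have not_above: "(y, z) \<notin> P" if "y \<in> level P j" "z \<in> level P i'" "i' \<le> j" "y \<noteq> z" for y z j i'
    using that rank_strict_mono[OF wg, of y z] by (auto simp: strictly_below_def level_def)
  have "u \<noteq> a" using a ub by blast
  then have ua: "incomparable P u a"
    using not_above ul a unfolding incomparable_def by blast
  have "u \<noteq> b" using ul b by (auto simp: level_def)
  then have "(u, b) \<notin> P"
    using ub covers_if_consecutive_rank[OF wg, of u b] ul b by (auto simp: strictly_below_def level_def)
  then have ub': "incomparable P u b"
    using not_above[OF b(1) ul] ul b unfolding incomparable_def level_def by auto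
  \<comment> \<open>A relation would pass through a cover \<open>c\<close> of \<open>u\<close> that
    \<open>w\<close> covers, and \<open>c\<close> would be all-seeing.\<close>
  have "(u, w) \<notin> P"
  proof
    assume "(u, w) \<in> P"
    then have "strictly_below P u w"
      using ul wl by (auto simp: strictly_below_def level_def)
    then obtain c where c: "covers P c u" "(c, w) \<in> P"
      using ex_cover_above[OF fp] by blast
    have cl: "c \<in> level P (i + 1)"
      using c(1) rank_covers[OF wg, of c u] covers_Field(2)[of P c u] ul by (simp add: level_def)
    then have "c \<noteq> w" using wl by (auto simp: level_def)
    then have "covers P w c"
      using cl covers_if_consecutive_rank[OF wg, of c w] c wl
      by (auto simp: strictly_below_def level_def)
    then show False using above_u below_w excl cl c by blast
  qed
  then have uw: "incomparable P u w"
    using not_above[OF wl ul] ul wl unfolding incomparable_def level_def by auto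
  show ?thesis
    unfolding three_plus_one_avoiding_def not_not
    using a b ul wl ua ub' uw
    by (intro bexI[of _ a] bexI[of _ b] bexI[of _ w] bexI[of _ u])
      (auto simp: level_def covers_def)
qed

theorem theorem4p9:
  fixes P :: "'a rel" and k :: nat
  assumes "sum_indecomposable P"
    and "height P = k + 2"
  shows "three_plus_one_avoiding P \<longleftrightarrow>
    (\<forall>i<k. \<not> (\<exists>v \<in> level P (i + 1). all_seeing P v) \<longrightarrow>
       \<not> (\<exists>u. isolated_lower P i u) \<or> \<not> (\<exists>w. isolated_upper P (i + 1) w))"
    (is "_ \<longleftrightarrow> ?Q")
proof -
  have sg: "strongly_graded P" and vg: "vigilant P"
    using assms(1) by (auto simp: sum_indecomposable_def trimmed_def)
  show ?thesis
  proof
    assume "three_plus_one_avoiding P"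
    then show ?Q
      using not_three_plus_one_avoiding_if_isolated[OF sg] assms(2)
      by (metis add_less_cancel_right)
  next
    assume Q: ?Q
    show "three_plus_one_avoiding P"
    proof (rule three_plus_one_avoiding_if_rank_gap[OF sg vg], rule ccontr)
      fix i u v
      assume uv: "u \<in> level P i" "v \<in> level P (i + 2)" "(u, v) \<notin> P"
      \<comment> \<open>The rank \<open>i + 2\<close> of \<open>v\<close> is less than the height
        \<open>k + 2\<close>, which puts \<open>i\<close> in the range of \<open>?Q\<close>.\<close>
      then have "i < k"
        using rank_less_height[OF sg, of v] assms(2) by (simp add: level_def)
      then show False
        using Q isolated_if_no_path[OF sg vg uv] by blast
    qed
  qed
qed

end
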